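(* Let $N\ge1$, let $x_1,\dots,x_N>0$, let $0<\lambda_{\min}\le\lambda_{\max}$, and let $\Lambda=\{\boldsymbol\lambda=(\lambda_1,\dots,\lambda_N):\lambda_{\min}\le\lambda_n\le\lambda_{\max}\ \forall n\}$. For each $n$ let $C_n:[0,\infty)\to\mathbb{R}$ be a quasiconvex and non-decreasing function with $C_n(0)=0$. Then the optimization problem $$\min_{\boldsymbol\lambda}\ C_{\mathrm{sys}}(\boldsymbol\lambda)=\max_{n}C_n\!\left(x_n+\frac{1+\sum_{k=1}^N\lambda_kx_k}{\lambda_n}\right)\quad\text{s.t.}\quad\boldsymbol\lambda\in\Lambda$$ is a quasiconvex program.
   Context: Here $x_n$ is the mean service time and $\lambda_n$ the update rate of entity $n$. A quasiconvex program is the minimization of a quasiconvex function over a convex set; a function on a convex set is quasiconvex if all of its sublevel sets are convex. *)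

theory Defs
  imports "HOL-Analysis.Analysis"
begin

definition quasiconvex_on :: "'a::real_vector set \<Rightarrow> ('a \<Rightarrow> real) \<Rightarrow> bool"
  where "quasiconvex_on S f \<longleftrightarrow> convex S \<and> (\<forall>\<alpha>. convex {x \<in> S. f x \<le> \<alpha>})"

(* The program "minimize f over S": convex feasible set S, objective quasiconvex on S.
   Attainment of the minimum is not part of the notion. *)
definition quasiconvex_program :: "('a::real_vector \<Rightarrow> real) \<Rightarrow> 'a set \<Rightarrow> bool"
  where "quasiconvex_program f S \<longleftrightarrow> convex S \<and> quasiconvex_on S f"

definition rate_box :: "real \<Rightarrow> real \<Rightarrow> (real ^ 'n) set"
  where "rate_box lmin lmax = {l. \<forall>n. lmin \<le> l $ n \<and> l $ n \<le> lmax}"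

(* Maximum over the nonempty finite set of entities, indexed by the type 'n. *)
definition C_sys :: "('n \<Rightarrow> real \<Rightarrow> real) \<Rightarrow> real ^ 'n \<Rightarrow> real ^ 'n \<Rightarrow> real"
  where "C_sys C x l =
    Max (range (\<lambda>n. C n (x $ n + (1 + (\<Sum>k\<in>UNIV. l $ k * x $ k)) / l $ n)))"

end

theory Submission
  imports Defs
begin

text \<open>
  The argument of \<open>C n\<close> is, up to the constant \<open>x $ n\<close>, an affine function of the rate
  vector divided by a positive coordinate. For a convex numerator \<open>f\<close> and a positive linear
  denominator \<open>g\<close>, the inequality \<open>f / g \<le> \<alpha>\<close> is equivalent to \<open>f - \<alpha> * g \<le> 0\<close>, a sublevel
  condition on a convex function; hence the ratio is quasiconvex although it is not convex in
  general (\<open>quasiconvex_on_divide_linear\<close>). Quasiconvexity survives composition with a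
  non-decreasing function (\<open>quasiconvex_on_mono_compose\<close>), here \<open>t \<mapsto> C n (x $ n + t)\<close>,
  and a maximum of finitely many functions, whose sublevel sets are intersections of sublevel
  sets (\<open>quasiconvex_on_Max\<close>).
\<close>

text \<open>The form of quasiconvexity that composes well: it speaks of values at points only, not of
  level sets, so a monotone function can be applied to both sides.\<close>
lemma quasiconvex_on_iff_max:
  "quasiconvex_on S f \<longleftrightarrow> convex S \<and>
    (\<forall>a\<in>S. \<forall>b\<in>S. \<forall>u\<ge>0. \<forall>v\<ge>0. u + v = 1 \<longrightarrow> f (u *\<^sub>R a + v *\<^sub>R b) \<le> max (f a) (f b))"
  (is "_ \<longleftrightarrow> _ \<and> ?M")
proof (cases "convex S")
  case True
  have "(\<forall>\<alpha>. convex {x \<in> S. f x \<le> \<alpha>}) \<longleftrightarrow> ?M"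
  proof
    assume level: "\<forall>\<alpha>. convex {x \<in> S. f x \<le> \<alpha>}"
    show ?M
    proof (intro ballI allI impI)
      fix a b and u v :: real
      assume "a \<in> S" "b \<in> S" "0 \<le> u" "0 \<le> v" "u + v = 1"
      \<comment> \<open>Both endpoints lie in the sublevel set at the larger of their two values.\<close>
      then show "f (u *\<^sub>R a + v *\<^sub>R b) \<le> max (f a) (f b)"
        using convexD[OF level[rule_format, of "max (f a) (f b)"], of a b u v] by auto
    qed
  next
    assume M: ?M
    show "\<forall>\<alpha>. convex {x \<in> S. f x \<le> \<alpha>}"
    proof (intro allI convexI)
      fix \<alpha> a b and u v :: real
      assume ab: "a \<in> {x \<in> S. f x \<le> \<alpha>}" "b \<in> {x \<in> S. f x \<le> \<alpha>}"
        and uv: "0 \<le> u" "0 \<le> v" "u + v = 1"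
      then have "f (u *\<^sub>R a + v *\<^sub>R b) \<le> max (f a) (f b)"
        using M by blast
      with ab uv show "u *\<^sub>R a + v *\<^sub>R b \<in> {x \<in> S. f x \<le> \<alpha>}"
        using convexD[OF True, of a b u v] by auto
    qed
  qed
  with True show ?thesis
    by (simp add: quasiconvex_on_def)
next
  case False
  then show ?thesis
    by (simp add: quasiconvex_on_def)
qed

lemma quasiconvex_on_mono_compose:
  assumes qc: "quasiconvex_on S f" and im: "f ` S \<subseteq> T" and mono: "mono_on T h"
  shows "quasiconvex_on S (\<lambda>x. h (f x))"
  unfolding quasiconvex_on_iff_max
proof (intro conjI ballI allI impI)
  show S: "convex S"
    using qc by (simp add: quasiconvex_on_def)
  fix a b and u v :: real
  assume ab: "a \<in> S" "b \<in> S" and uv: "0 \<le> u" "0 \<le> v" "u + v = 1"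
  let ?z = "u *\<^sub>R a + v *\<^sub>R b"
  have T: "f a \<in> T" "f b \<in> T" "f ?z \<in> T"
    using im ab convexD[OF S ab uv] by auto
  have "f ?z \<le> f a \<or> f ?z \<le> f b"
    using qc ab uv unfolding quasiconvex_on_iff_max le_max_iff_disj by blast
  then show "h (f ?z) \<le> max (h (f a)) (h (f b))"
    using mono_onD[OF mono] T by (auto simp: le_max_iff_disj)
qed

text \<open>Linearity of the denominator, rather than concavity, makes \<open>f - \<alpha> * g\<close> convex for
  \<open>\<alpha>\<close> of either sign, so the numerator may take negative values.\<close>
lemma quasiconvex_on_divide_linear:
  assumes f: "convex_on S f" and g: "linear g" and pos: "\<And>x. x \<in> S \<Longrightarrow> 0 < g x"
  shows "quasiconvex_on S (\<lambda>x. f x / g x)"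
  unfolding quasiconvex_on_def
proof (intro conjI allI)
  show S: "convex S"
    using f by (rule convex_on_imp_convex)
  fix \<alpha>
  have "convex {x \<in> S. f x - \<alpha> * g x \<le> 0}"
  proof (rule convexI)
    fix a b and u v :: real
    assume ab: "a \<in> {x \<in> S. f x - \<alpha> * g x \<le> 0}" "b \<in> {x \<in> S. f x - \<alpha> * g x \<le> 0}"
      and uv: "0 \<le> u" "0 \<le> v" "u + v = 1"
    have "f (u *\<^sub>R a + v *\<^sub>R b) \<le> u * f a + v * f b"
      using f ab uv by (auto simp: convex_on_def)
    also have "\<dots> \<le> u * (\<alpha> * g a) + v * (\<alpha> * g b)"
      using ab uv by (intro add_mono mult_left_mono) auto
    also have "\<dots> = \<alpha> * g (u *\<^sub>R a + v *\<^sub>R b)"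
      by (simp add: linear_add[OF g] linear_cmul[OF g] algebra_simps)
    finally show "u *\<^sub>R a + v *\<^sub>R b \<in> {x \<in> S. f x - \<alpha> * g x \<le> 0}"
      using ab uv convexD[OF S, of a b u v] by auto
  qed
  also have "{x \<in> S. f x - \<alpha> * g x \<le> 0} = {x \<in> S. f x / g x \<le> \<alpha>}"
    using pos by (auto simp: pos_divide_le_eq)
  finally show "convex {x \<in> S. f x / g x \<le> \<alpha>}" .
qed

lemma quasiconvex_on_Max:
  assumes I: "finite I" "I \<noteq> {}" and qc: "\<And>i. i \<in> I \<Longrightarrow> quasiconvex_on S (f i)"
  shows "quasiconvex_on S (\<lambda>x. Max ((\<lambda>i. f i x) ` I))"
  unfolding quasiconvex_on_def
proof (intro conjI allI)
  show "convex S"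
    using I qc by (auto simp: quasiconvex_on_def)
  fix \<alpha>
  have "{x \<in> S. Max ((\<lambda>i. f i x) ` I) \<le> \<alpha>} = (\<Inter>i\<in>I. {x \<in> S. f i x \<le> \<alpha>})"
    using I by auto
  also have "convex \<dots>"
    using qc by (intro convex_INT) (auto simp: quasiconvex_on_def)
  finally show "convex {x \<in> S. Max ((\<lambda>i. f i x) ` I) \<le> \<alpha>}" .
qed

lemma convex_rate_box: "convex (rate_box lmin lmax :: (real ^ 'n) set)"
proof -
  have "(rate_box lmin lmax :: (real ^ 'n) set) = cbox (\<chi> i. lmin) (\<chi> i. lmax)"
    by (auto simp: rate_box_def mem_box_cart)
  then show ?thesis
    by simp
qed

theorem lemma2:
  fixes x :: "real ^ 'n"
    and C :: "'n \<Rightarrow> real \<Rightarrow> real"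
    and lmin lmax :: real
  assumes "\<And>n. x $ n > 0"
    and "0 < lmin" and "lmin \<le> lmax"
    and "\<And>n. quasiconvex_on {0..} (C n)"
    and "\<And>n. mono_on {0..} (C n)"
    and "\<And>n. C n 0 = 0"
  shows "quasiconvex_program (C_sys C x) (rate_box lmin lmax)"
proof -
  let ?S = "rate_box lmin lmax :: (real ^ 'n) set"
  let ?num = "\<lambda>l :: real ^ 'n. 1 + (\<Sum>k\<in>UNIV. l $ k * x $ k)"
  have l_pos: "0 < l $ n" if "l \<in> ?S" for l n
    using that \<open>0 < lmin\<close> less_le_trans by (auto simp: rate_box_def)
  have "convex_on ?S ?num"
  proof (rule convex_onI)
    fix t :: real and a b :: "real ^ 'n"
    have "?num ((1 - t) *\<^sub>R a + t *\<^sub>R b) = (1 - t) * ?num a + t * ?num b"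
      by (simp add: sum_distrib_left distrib_left distrib_right sum.distrib mult.assoc)
    then show "?num ((1 - t) *\<^sub>R a + t *\<^sub>R b) \<le> (1 - t) * ?num a + t * ?num b"
      by simp
  qed (rule convex_rate_box)
  then have ratio: "quasiconvex_on ?S (\<lambda>l. ?num l / l $ n)" for n
    using l_pos by (intro quasiconvex_on_divide_linear linearI) auto
  have "quasiconvex_on ?S (\<lambda>l. C n (x $ n + ?num l / l $ n))" for n
  proof (rule quasiconvex_on_mono_compose[OF ratio, where T = "{0..}"])
    have "0 \<le> ?num l / l $ n" if "l \<in> ?S" for l
      using l_pos[OF that] assms(1)
      by (intro divide_nonneg_nonneg add_nonneg_nonneg sum_nonneg mult_nonneg_nonneg)
        (auto intro: less_imp_le)
    then show "(\<lambda>l. ?num l / l $ n) ` ?S \<subseteq> {0..}"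
      by auto
    show "mono_on {0..} (\<lambda>t. C n (x $ n + t))"
      using assms(1)[of n] by (intro mono_onI mono_onD[OF assms(5)]) auto
  qed
  then have "quasiconvex_on ?S (C_sys C x)"
    unfolding C_sys_def by (intro quasiconvex_on_Max) auto
  then show ?thesis
    by (simp add: quasiconvex_program_def convex_rate_box)
qed

end
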